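(* Let $p$ be an odd prime and let $F\colon\mathbb{F}_{p^n}\to\mathbb{F}_{p^n}$ be a plateaued, $2$-to-$1$ function. Then $F$ is planar.
   Context: Let $\zeta_p=e^{2\pi i/p}$ and let $\operatorname{Tr}$ be the absolute trace $\mathbb{F}_{p^n}\to\mathbb{F}_p$. The Walsh transform of $F$ is $W_F(b,a)=\sum_{x\in\mathbb{F}_{p^n}}\zeta_p^{\operatorname{Tr}(bF(x))-\operatorname{Tr}(ax)}$. $F$ is plateaued if for every $b\in\mathbb{F}_{p^n}^*$ there is an integer $s_b$ with $0\le s_b\le n$ such that $|W_F(b,a)|\in\{0,p^{(n+s_b)/2}\}$ for all $a\in\mathbb{F}_{p^n}$. $F$ is $2$-to-$1$ if exactly one element of $\mathbb{F}_{p^n}$ has exactly one preimage and $(p^n-1)/2$ elements have exactly $2$ preimages. $F$ is planar if for every $a\in\mathbb{F}_{p^n}^*$ and every $b\in\mathbb{F}_{p^n}$ the equation $F(x+a)-F(x)=b$ has exactly one solution $x$ (equivalently, $|W_F(b,a)|=p^{n/2}$ for all $b\neq0$ and all $a$). *)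

theory Defs
  imports Complex_Main "HOL-Library.Cardinality" "HOL-Computational_Algebra.Computational_Algebra" "HOL-Number_Theory.Cong"
begin

text \<open>
  The field with \<open>p ^ n\<close> elements is a type of class \<open>finite_field\<close> and cardinality \<open>p ^ n\<close>.
  Its prime field is the set of the \<open>p\<close> elements \<open>of_nat k\<close>, \<open>k < p\<close>. The trace takes its values
  there (\<open>abs_trace_prime_field\<close> below), but as an element of the big field, so it is turned into
  its least nonnegative representative before it is used as an exponent.
\<close>

definition abs_trace :: "nat \<Rightarrow> nat \<Rightarrow> 'a::finite_field \<Rightarrow> 'a" where
  "abs_trace p n x = (\<Sum>i<n. x ^ (p ^ i))"

definition prime_field_rep :: "nat \<Rightarrow> 'a::finite_field \<Rightarrow> nat" where
  "prime_field_rep p y = (THE k. k < p \<and> of_nat k = y)"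

definition trace_rep :: "nat \<Rightarrow> nat \<Rightarrow> 'a::finite_field \<Rightarrow> int" where
  "trace_rep p n x = int (prime_field_rep p (abs_trace p n x))"

definition zeta :: "nat \<Rightarrow> complex" where
  "zeta p = exp (2 * of_real pi * \<i> / of_nat p)"

definition walsh :: "nat \<Rightarrow> nat \<Rightarrow> ('a::finite_field \<Rightarrow> 'a) \<Rightarrow> 'a \<Rightarrow> 'a \<Rightarrow> complex" where
  "walsh p n F b a = (\<Sum>x\<in>UNIV. zeta p powi (trace_rep p n (b * F x) - trace_rep p n (a * x)))"

definition plateaued :: "nat \<Rightarrow> nat \<Rightarrow> ('a::finite_field \<Rightarrow> 'a) \<Rightarrow> bool" where
  "plateaued p n F \<longleftrightarrow>
     (\<forall>b. b \<noteq> 0 \<longrightarrow>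
       (\<exists>s::nat. s \<le> n \<and>
         (\<forall>a. norm (walsh p n F b a) \<in> {0, real p powr ((real n + real s) / 2)})))"

definition two_to_one :: "nat \<Rightarrow> nat \<Rightarrow> ('a::finite_field \<Rightarrow> 'a) \<Rightarrow> bool" where
  "two_to_one p n F \<longleftrightarrow>
     card {y. card (F -` {y}) = 1} = 1 \<and>
     card {y. card (F -` {y}) = 2} = (p ^ n - 1) div 2"

definition planar :: "('a::finite_field \<Rightarrow> 'a) \<Rightarrow> bool" where
  "planar F \<longleftrightarrow> (\<forall>a b. a \<noteq> 0 \<longrightarrow> (\<exists>!x. F (x + a) - F x = b))"

lemma CHAR_eq:
  assumes "prime p" "CARD('a::finite_field) = p ^ n"
  shows "CHAR('a) = p"
proof -
  have "CHAR('a) dvd p ^ n"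
  proof -
    have "(\<Sum>x\<in>UNIV. x :: 'a) = (\<Sum>x\<in>UNIV. x + 1)"
      by (rule sum.reindex_bij_witness[of _ "\<lambda>x. x + 1" "\<lambda>x. x - 1"]) auto
    then have "(of_nat (CARD('a)) :: 'a) = 0"
      by (simp add: sum.distrib)
    then show ?thesis
      using assms(2) by (simp only: of_nat_eq_0_iff_char_dvd)
  qed
  then show ?thesis
    using assms(1) CHAR_prime[where 'a = 'a] by (metis prime_dvd_power primes_dvd_imp_eq)
qed

lemma prime_field_iff:
  fixes y :: "'a::finite_field"
  assumes "p = CHAR('a)"
  shows "(\<exists>!k. k < p \<and> of_nat k = y) \<longleftrightarrow> y ^ p = y"
proof -
  have p: "prime p" using assms by simp
  have inj: "inj_on (of_nat :: nat \<Rightarrow> 'a) {..<p}"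
    using assms by (auto simp: inj_on_def of_nat_eq_iff_cong_CHAR cong_def)
  define q :: "'a poly" where "q = monom 1 p - monom 1 1"
  have p1: "p > 1" using p prime_gt_1_nat by blast
  have deg: "degree q \<le> p"
    unfolding q_def using p1 by (intro degree_diff_le) (auto simp: degree_monom_eq)
  have "coeff q p = 1" using p1 by (simp add: q_def)
  then have "q \<noteq> 0" by auto
  then have "card {x. poly q x = 0} \<le> p"
    using card_poly_roots_bound[of q] deg by simp
  moreover have roots: "{x. poly q x = 0} = {x. x ^ p = x}"
    by (auto simp: q_def poly_monom)
  moreover have sub: "of_nat ` {..<p} \<subseteq> {x::'a. x ^ p = x}"
  proof safe
    fix k :: nat
    have "(\<Sum>i<k. 1 :: 'a) ^ p = (\<Sum>i<k. 1 ^ p)"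
      by (rule freshmans_dream_sum) (use assms in auto)
    then show "(of_nat k :: 'a) ^ p = of_nat k" by simp
  qed
  moreover have "card (of_nat ` {..<p} :: 'a set) = p"
    using inj by (simp add: card_image)
  ultimately have eq: "of_nat ` {..<p} = {x::'a. x ^ p = x}"
    by (intro card_seteq) auto
  show ?thesis
  proof
    assume "\<exists>!k. k < p \<and> of_nat k = y"
    then have "y \<in> of_nat ` {..<p}" by blast
    then show "y ^ p = y" using eq by blast
  next
    assume "y ^ p = y"
    then have "y \<in> of_nat ` {..<p}" using eq by blast
    then obtain k where "k < p" "of_nat k = y" by auto
    then show "\<exists>!k. k < p \<and> of_nat k = y"
      using inj by (auto simp: inj_on_def)
  qed
qed

lemma abs_trace_prime_field:
  fixes x :: "'a::finite_field"
  assumes "prime p" "CARD('a) = p ^ n"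
  shows "\<exists>!k. k < p \<and> of_nat k = abs_trace p n x"
proof -
  have ch: "p = CHAR('a)" using CHAR_eq[OF assms] by simp
  have n: "n > 0"
  proof (rule ccontr)
    assume "\<not> n > 0"
    then have "CARD('a) = 1" using assms(2) by simp
    then obtain a :: 'a where "UNIV = {a}" by (auto simp: card_1_singleton_iff)
    then show False by (metis UNIV_I singletonD zero_neq_one)
  qed
  have "abs_trace p n x ^ p = (\<Sum>i<n. (x ^ (p ^ i)) ^ p)"
    unfolding abs_trace_def by (rule freshmans_dream_sum) (use assms ch in auto)
  also have "\<dots> = (\<Sum>i<n. x ^ (p ^ Suc i))"
    by (simp add: power_mult[symmetric] mult.commute)
  also have "\<dots> = (\<Sum>i<Suc n. x ^ (p ^ i)) - x"
    by (subst sum.lessThan_Suc_shift) simp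
  also have "\<dots> = abs_trace p n x + x ^ (p ^ n) - x"
    by (simp add: abs_trace_def)
  also have "x ^ (p ^ n) = x"
    using finite_field_power_card_eq_same[of x] assms(2) by simp
  finally show ?thesis
    using prime_field_iff[OF ch] by simp
qed

end

theory Submission
  imports Defs "HOL-Analysis.Complex_Transcendental" "Jordan_Normal_Form.Char_Poly"
begin

text \<open>
  Since \<open>F\<close> takes one value once and all its other values twice, \<open>W b 0\<close> is a root of unity plus
  twice a sum of roots of unity. It is not zero, because \<open>1 / 2\<close> is not an algebraic integer, so
  plateauedness gives \<open>\<bar>W b 0\<bar>\<^sup>2 \<ge> p ^ n\<close> for all \<open>b \<noteq> 0\<close>. Counting the pairs with
  \<open>F x = F y\<close> shows that the average of \<open>\<bar>W b 0\<bar>\<^sup>2\<close> over \<open>b \<noteq> 0\<close> is exactly \<open>p ^ n\<close>, hence every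
  amplitude is \<open>p ^ n\<close>. By Parseval's identity in \<open>a\<close> no \<open>W b a\<close> with \<open>b \<noteq> 0\<close> can then vanish, and a
  flat Walsh spectrum means planarity.
\<close>

section \<open>Sums of roots of unity as algebraic integers\<close>

text \<open>The equations say that \<open>x\<close> is an eigenvalue of the integer matrix
  \<open>c\<close> with the nonzero eigenvector \<open>b\<close>, hence a root of its monic integral
  characteristic polynomial.\<close>

lemma algebraic_int_if_int_matrix:
  fixes x :: complex and b :: "nat \<Rightarrow> complex" and c :: "nat \<Rightarrow> nat \<Rightarrow> int"
  assumes "k < m" "b k \<noteq> 0"
    and eq: "\<And>i. i < m \<Longrightarrow> x * b i = (\<Sum>j<m. of_int (c i j) * b j)"
  shows "algebraic_int x"
proof -
  define C where "C = mat m m (\<lambda>(i, j). c i j)"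
  have C: "C \<in> carrier_mat m m" by (simp add: C_def)
  let ?C = "map_mat of_int C :: complex mat"
  have dim: "?C \<in> carrier_mat m m" using C by simp
  have "vec_index (vec m b) k \<noteq> vec_index (0\<^sub>v m) k" using assms(1,2) by simp
  then have "vec m b \<noteq> 0\<^sub>v m" by metis
  moreover have "?C *\<^sub>v vec m b = x \<cdot>\<^sub>v vec m b"
  proof (rule eq_vecI)
    fix i assume "i < dim_vec (x \<cdot>\<^sub>v vec m b)"
    then have i: "i < m" by simp
    then have "vec_index (?C *\<^sub>v vec m b) i = (\<Sum>j<m. of_int (c i j) * b j)"
      by (simp add: C_def scalar_prod_def atLeast0LessThan)
    then show "vec_index (?C *\<^sub>v vec m b) i = vec_index (x \<cdot>\<^sub>v vec m b) i"
      by (simp only: eq[OF i, symmetric]) (simp add: i)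
  qed (use dim in simp)
  ultimately have "eigenvector ?C (vec m b) x"
    using dim by (simp only: eigenvector_def) simp
  then have "poly (char_poly ?C) x = 0"
    using eigenvalue_root_char_poly[OF dim, of x] unfolding eigenvalue_def by blast
  then have "poly (map_poly of_int (char_poly C)) x = 0"
    unfolding of_int_hom.char_poly_hom[OF C] .
  moreover have "lead_coeff (char_poly C) = 1"
    using degree_monic_char_poly[OF C] by simp
  ultimately show ?thesis
    unfolding algebraic_int_altdef_ipoly by blast
qed

text \<open>Every summand is a power of \<open>w\<close>, so multiplication by the sum sends each of
  \<open>w ^ 0, ..., w ^ (p - 1)\<close> to an integer combination of these powers. Grouping by the
  exponent modulo \<open>p\<close> gives the matrix entries.\<close>

lemma algebraic_int_sum_roots_of_unity:
  fixes z :: "'b \<Rightarrow> complex"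
  assumes "finite I" "p > 0" and unit: "\<And>l. l \<in> I \<Longrightarrow> z l ^ p = 1"
  shows "algebraic_int (\<Sum>l\<in>I. z l)"
proof -
  define w where "w = cis (2 * pi / real p)"
  have wp: "w ^ p = 1" using \<open>p > 0\<close> by (simp add: w_def Complex.DeMoivre)
  have "\<exists>k. z l = w ^ k" if "l \<in> I" for l
  proof -
    have "z l \<in> (\<lambda>k. cis (2 * pi * real k / real p)) ` {..<p}"
      using Complex.bij_betw_roots_unity[OF \<open>p > 0\<close>] unit[OF that] by (auto simp: bij_betw_def)
    then show ?thesis by (auto simp: w_def Complex.DeMoivre algebra_simps)
  qed
  then obtain k where k: "\<And>l. l \<in> I \<Longrightarrow> z l = w ^ k l" by metis
  have w_mod: "w ^ (j mod p) = w ^ j" for j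
  proof -
    have "w ^ j = w ^ (p * (j div p) + j mod p)" by simp
    also have "\<dots> = w ^ (j mod p)" by (simp only: power_add power_mult wp) simp
    finally show ?thesis by simp
  qed
  show ?thesis
  proof (rule algebraic_int_if_int_matrix[of 0 p])
    fix i assume "i < p"
    have "(\<Sum>l\<in>I. z l) * w ^ i = (\<Sum>l\<in>I. w ^ ((k l + i) mod p))"
      by (simp add: sum_distrib_right k w_mod power_add)
    also have "\<dots> = (\<Sum>j<p. \<Sum>l | l \<in> I \<and> (k l + i) mod p = j. w ^ ((k l + i) mod p))"
      by (rule sum.group[symmetric]) (use assms in auto)
    also have "\<dots> = (\<Sum>j<p. of_int (int (card {l \<in> I. (k l + i) mod p = j})) * w ^ j)"
      by (rule sum.cong) auto
    finally show "(\<Sum>l\<in>I. z l) * w ^ i = \<dots>" .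
  qed (use \<open>p > 0\<close> in auto)
qed

text \<open>Division by \<open>u\<close> would make \<open>- 1 / 2\<close> a sum of roots of unity,
  thus a rational algebraic integer and so an integer.\<close>

lemma root_of_unity_plus_double_sum_nonzero:
  fixes z :: "'b \<Rightarrow> complex"
  assumes "finite I" "p > 0" "u ^ p = 1" "\<And>l. l \<in> I \<Longrightarrow> z l ^ p = 1"
  shows "u + 2 * (\<Sum>l\<in>I. z l) \<noteq> 0"
proof
  assume *: "u + 2 * (\<Sum>l\<in>I. z l) = 0"
  have u: "u \<noteq> 0" using assms(2,3) by (auto simp: power_0_left)
  define s where "s = (\<Sum>l\<in>I. z l / u)"
  have "algebraic_int s"
    unfolding s_def
    by (rule algebraic_int_sum_roots_of_unity[OF assms(1,2)]) (simp add: assms power_divide)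
  moreover have s: "s = - 1 / 2"
    using * u by (simp add: s_def sum_divide_distrib[symmetric] field_simps add_eq_0_iff)
  then have "s \<in> \<rat>" by simp
  ultimately have "s \<in> \<int>" using rational_algebraic_int_is_int by blast
  then obtain m :: int where "s = of_int m" by (auto elim: Ints_cases)
  then have "(of_int (2 * m) :: complex) = 2 * s" by simp
  then have "of_int (2 * m) = (of_int (- 1) :: complex)" unfolding s by simp
  then have "2 * m = - 1" by (simp only: of_int_eq_iff)
  then show False by presburger
qed

section \<open>Fibre sizes of a 2-to-1 function\<close>

lemma sum_card_vimage:
  fixes F :: "'a::finite \<Rightarrow> 'a" and f :: "'a \<Rightarrow> 'b::comm_semiring_1"
  shows "(\<Sum>x\<in>UNIV. f (F x)) = (\<Sum>y\<in>UNIV. of_nat (card (F -` {y})) * f y)"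
proof -
  have "(\<Sum>x\<in>UNIV. f (F x)) = (\<Sum>y\<in>UNIV. \<Sum>x | x \<in> UNIV \<and> F x = y. f (F x))"
    by (rule sum.group[symmetric]) auto
  also have "\<dots> = (\<Sum>y\<in>UNIV. of_nat (card (F -` {y})) * f y)"
    by (rule sum.cong) (auto simp: vimage_def)
  finally show ?thesis .
qed

text \<open>The fibres of size one and two already exhaust the domain, so all other fibres are
  empty. The second argument of \<open>f\<close> lets one formula serve both character sums and the
  sum of squared fibre sizes.\<close>

lemma two_to_one_sum:
  fixes F :: "'a::finite_field \<Rightarrow> 'a"
  assumes F: "two_to_one p n F" and card: "CARD('a) = p ^ n" and "odd p"
  shows "\<exists>y0 D. 2 * card D + 1 = CARD('a) \<and> (\<forall>f :: 'a \<Rightarrow> nat \<Rightarrow> complex.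
    (\<Sum>y\<in>UNIV. of_nat (card (F -` {y})) * f y (card (F -` {y}))) = f y0 1 + 2 * (\<Sum>y\<in>D. f y 2))"
proof -
  let ?c = "\<lambda>y. card (F -` {y})"
  obtain y0 where y0: "{y. ?c y = 1} = {y0}"
    using F unfolding two_to_one_def by (auto simp: card_1_singleton_iff)
  define D where "D = {y. ?c y = 2}"
  \<comment> \<open>As \<open>p\<close> is odd, \<open>p ^ n - 1\<close> is even and the
    \<open>div\<close> is exact.\<close>
  have cD: "2 * card D + 1 = CARD('a)"
    using F card \<open>odd p\<close> unfolding two_to_one_def D_def by simp
  have c0: "?c y0 = 1" using y0 by auto
  have nD: "y0 \<notin> D" using c0 by (simp add: D_def)
  have "CARD('a) = (\<Sum>y\<in>UNIV. ?c y)"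
    using sum_card_vimage[of "\<lambda>_. 1::nat" F] by simp
  also have "\<dots> = (\<Sum>y\<in>insert y0 D. ?c y) + (\<Sum>y\<in>- insert y0 D. ?c y)"
    by (subst sum.union_disjoint[symmetric]) (auto intro: sum.cong)
  also have "(\<Sum>y\<in>insert y0 D. ?c y) = CARD('a)"
    using nD c0 cD by (simp add: D_def)
  finally have z: "?c y = 0" if "y \<notin> insert y0 D" for y using that by simp
  have "(\<Sum>y\<in>UNIV. of_nat (?c y) * f y (?c y)) = f y0 1 + 2 * (\<Sum>y\<in>D. f y 2)"
    for f :: "'a \<Rightarrow> nat \<Rightarrow> complex"
  proof -
    have "(\<Sum>y\<in>UNIV. of_nat (?c y) * f y (?c y)) = (\<Sum>y\<in>insert y0 D. of_nat (?c y) * f y (?c y))"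
      by (rule sum.mono_neutral_right) (use z in auto)
    also have "\<dots> = f y0 1 + 2 * (\<Sum>y\<in>D. f y 2)"
      using nD c0 by (simp add: D_def sum_distrib_left)
    finally show ?thesis .
  qed
  then show ?thesis using cD by blast
qed

section \<open>Additive characters and Walsh transforms\<close>

text \<open>This isolates what the argument needs of the map from \<open>x\<close> to
  \<open>zeta\<close> raised to the trace of \<open>x\<close>: it is a nontrivial character of the
  additive group.\<close>

locale additive_character =
  fixes chi :: "'a::finite_field \<Rightarrow> complex"
  assumes zero [simp]: "chi 0 = 1"
    and add: "chi (x + y) = chi x * chi y"
    and nontrivial: "\<exists>x. chi x \<noteq> 1"
begin

lemma power: "chi x ^ k = chi (of_nat k * x)"
  by (induction k) (simp_all add: add algebra_simps)

lemma power_CHAR: "chi x ^ CHAR('a) = 1"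
  by (simp add: power)

lemma norm_eq_1 [simp]: "norm (chi x) = 1"
proof -
  have "norm (chi x) ^ CHAR('a) = 1"
    using power_CHAR[of x] by (metis norm_one norm_power)
  then show ?thesis
    using power_eq_imp_eq_base[of "norm (chi x)" "CHAR('a)" 1] by simp
qed

lemma cnj_eq: "cnj (chi x) = chi (- x)"
proof -
  have "chi x * cnj (chi x) = 1"
    by (simp add: complex_norm_square[symmetric])
  moreover have "chi x * chi (- x) = 1"
    by (simp add: add[symmetric])
  ultimately show ?thesis
    by (metis mult_cancel_left mult_zero_left zero_neq_one)
qed

lemma sum_eq_0: "(\<Sum>x\<in>UNIV. chi x) = 0"
proof -
  obtain y where y: "chi y \<noteq> 1" using nontrivial by blast
  have "(\<Sum>x\<in>UNIV. chi x) = (\<Sum>x\<in>UNIV. chi (y + x))"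
    by (rule sum.reindex_bij_witness[of _ "\<lambda>x. y + x" "\<lambda>x. x - y"]) auto
  also have "\<dots> = chi y * (\<Sum>x\<in>UNIV. chi x)"
    by (simp add: add sum_distrib_left)
  finally show ?thesis using y by simp
qed

lemma orthogonality: "(\<Sum>c\<in>UNIV. chi (c * y)) = (if y = 0 then of_nat CARD('a) else 0)"
proof (cases "y = 0")
  case False
  have "(\<Sum>c\<in>UNIV. chi (c * y)) = (\<Sum>x\<in>UNIV. chi x)"
    by (rule sum.reindex_bij_witness[of _ "\<lambda>x. x / y" "\<lambda>c. c * y"]) (use False in auto)
  then show ?thesis using False sum_eq_0 by simp
qed simp

text \<open>Expanding the square and summing over \<open>c\<close> first, orthogonality keeps just
  the pairs with \<open>g x - g y + d = 0\<close>. Two instances are used: \<open>g = uminus\<close>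
  sums over the linear argument \<open>a\<close> of the Walsh transform, and \<open>g = F\<close>
  over its multiplier \<open>b\<close>.\<close>

lemma parseval:
  fixes g h :: "'a \<Rightarrow> 'a"
  shows "(\<Sum>c\<in>UNIV. chi (c * d) * of_real ((norm (\<Sum>x\<in>UNIV. chi (c * g x + h x)))\<^sup>2))
    = of_nat CARD('a) * (\<Sum>y\<in>UNIV. \<Sum>x\<in>UNIV. if g x - g y + d = 0 then chi (h x - h y) else 0)"
proof -
  have "chi (c * d) * of_real ((norm (\<Sum>x\<in>UNIV. chi (c * g x + h x)))\<^sup>2)
      = (\<Sum>y\<in>UNIV. \<Sum>x\<in>UNIV. chi (h x - h y) * chi (c * (g x - g y + d)))" for c
  proof -
    have "chi (c * d) * of_real ((norm (\<Sum>x\<in>UNIV. chi (c * g x + h x)))\<^sup>2)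
      = chi (c * d) * (\<Sum>x\<in>UNIV. \<Sum>y\<in>UNIV. chi (c * g x + h x) * chi (- (c * g y + h y)))"
      by (simp only: complex_norm_square cnj_sum cnj_eq sum_product)
    also have "\<dots> = (\<Sum>x\<in>UNIV. \<Sum>y\<in>UNIV. chi (h x - h y) * chi (c * (g x - g y + d)))"
      unfolding sum_distrib_left
      by (intro sum.cong refl) (simp add: add[symmetric] algebra_simps)
    also have "\<dots> = (\<Sum>y\<in>UNIV. \<Sum>x\<in>UNIV. chi (h x - h y) * chi (c * (g x - g y + d)))"
      by (rule sum.swap)
    finally show ?thesis .
  qed
  then have "(\<Sum>c\<in>UNIV. chi (c * d) * of_real ((norm (\<Sum>x\<in>UNIV. chi (c * g x + h x)))\<^sup>2))
      = (\<Sum>c\<in>UNIV. \<Sum>y\<in>UNIV. \<Sum>x\<in>UNIV. chi (h x - h y) * chi (c * (g x - g y + d)))"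
    by simp
  also have "\<dots> = (\<Sum>y\<in>UNIV. \<Sum>c\<in>UNIV. \<Sum>x\<in>UNIV. chi (h x - h y) * chi (c * (g x - g y + d)))"
    by (rule sum.swap)
  also have "\<dots> = (\<Sum>y\<in>UNIV. \<Sum>x\<in>UNIV. \<Sum>c\<in>UNIV. chi (h x - h y) * chi (c * (g x - g y + d)))"
    by (intro sum.cong refl sum.swap)
  also have "\<dots> = (\<Sum>y\<in>UNIV. \<Sum>x\<in>UNIV. chi (h x - h y) *
      (if g x - g y + d = 0 then of_nat CARD('a) else 0))"
    by (simp only: sum_distrib_left[symmetric] orthogonality)
  also have "\<dots> = of_nat CARD('a) *
      (\<Sum>y\<in>UNIV. \<Sum>x\<in>UNIV. if g x - g y + d = 0 then chi (h x - h y) else 0)"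
    unfolding sum_distrib_left by (intro sum.cong refl) auto
  finally show ?thesis .
qed

definition W :: "('a \<Rightarrow> 'a) \<Rightarrow> 'a \<Rightarrow> 'a \<Rightarrow> complex" where
  "W F b a = (\<Sum>x\<in>UNIV. chi (b * F x - a * x))"

text \<open>For \<open>d = 0\<close> this is Parseval's identity in \<open>a\<close>; for
  \<open>d\<close> nonzero it links the Walsh spectrum to the derivative of \<open>F\<close> in
  direction \<open>d\<close>.\<close>

lemma W_autocorrelation:
  "(\<Sum>a\<in>UNIV. chi (a * d) * of_real ((norm (W F b a))\<^sup>2))
    = of_nat CARD('a) * (\<Sum>y\<in>UNIV. chi (b * (F (y + d) - F y)))"
proof -
  have "(\<Sum>x\<in>UNIV. if - x - (- y) + d = 0 then chi (b * F x - b * F y) else 0)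
      = chi (b * (F (y + d) - F y))" for y
  proof -
    have "- x - (- y) + d = 0 \<longleftrightarrow> x = y + d" for x
      by (metis add.commute add.inverse_inverse add_uminus_conv_diff diff_add_eq eq_iff_diff_eq_0)
    then show ?thesis by (simp add: right_diff_distrib)
  qed
  then show ?thesis
    using parseval[of d uminus "\<lambda>x. b * F x"] by (simp add: W_def)
qed

lemma W_sum_norm_sq: "(\<Sum>a\<in>UNIV. (norm (W F b a))\<^sup>2) = (real CARD('a))\<^sup>2"
proof -
  have "of_real (\<Sum>a\<in>UNIV. (norm (W F b a))\<^sup>2) = (of_real ((real CARD('a))\<^sup>2) :: complex)"
    using W_autocorrelation[of 0 F b] by (simp add: power2_eq_square)
  then show ?thesis by (simp only: of_real_eq_iff)
qed

text \<open>The second moment over \<open>b\<close> counts the pairs with \<open>F x = F y\<close>,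
  here regrouped by their common value.\<close>

lemma sum_norm_sq_W_0:
  "(\<Sum>b\<in>UNIV. complex_of_real ((norm (W F b 0))\<^sup>2))
    = of_nat CARD('a) * (\<Sum>y\<in>UNIV. of_nat (card (F -` {y})) * of_nat (card (F -` {y})))"
proof -
  have "(\<Sum>b\<in>UNIV. complex_of_real ((norm (W F b 0))\<^sup>2))
      = of_nat CARD('a) * (\<Sum>y\<in>UNIV. \<Sum>x\<in>UNIV. if F x = F y then 1 else 0)"
    using parseval[of 0 F "\<lambda>_. 0"] by (simp add: W_def cong: if_cong)
  also have "\<dots> = of_nat CARD('a) * (\<Sum>y\<in>UNIV. of_nat (card (F -` {F y})))"
    by (simp add: sum.If_cases vimage_def)
  also have "(\<Sum>y\<in>UNIV. of_nat (card (F -` {F y})) :: complex)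
      = (\<Sum>y\<in>UNIV. of_nat (card (F -` {y})) * of_nat (card (F -` {y})))"
    by (rule sum_card_vimage)
  finally show ?thesis .
qed

text \<open>A flat spectrum has zero autocorrelation at every nonzero shift \<open>d\<close>, so all
  nontrivial character sums of the derivative in direction \<open>d\<close> vanish. The derivative
  is then equidistributed, taking each value once.\<close>

lemma planar_if_flat:
  assumes flat: "\<And>a b. b \<noteq> 0 \<Longrightarrow> (norm (W F b a))\<^sup>2 = real CARD('a)"
  shows "planar F"
  unfolding planar_def
proof (intro allI impI)
  fix d b :: 'a assume d: "d \<noteq> 0"
  let ?S = "{x. F (x + d) - F x = b}"
  have zero: "(\<Sum>y\<in>UNIV. chi (c * (F (y + d) - F y))) = 0" if "c \<noteq> 0" for c
  proof -
    have "of_nat CARD('a) * (\<Sum>y\<in>UNIV. chi (c * (F (y + d) - F y)))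
        = (\<Sum>a\<in>UNIV. chi (a * d)) * of_nat CARD('a)"
      unfolding W_autocorrelation[symmetric] using flat[OF that] by (simp add: sum_distrib_right)
    then show ?thesis using orthogonality[of d] d by simp
  qed
  \<comment> \<open>Orthogonality detects the solutions; after swapping the sums only
    \<open>c = 0\<close> contributes.\<close>
  have "of_nat CARD('a) * (of_nat (card ?S) :: complex)
      = (\<Sum>y\<in>UNIV. \<Sum>c\<in>UNIV. chi (c * (F (y + d) - F y - b)))"
    unfolding orthogonality by (simp add: sum.If_cases)
  also have "\<dots> = (\<Sum>c\<in>UNIV. chi (- c * b) * (\<Sum>y\<in>UNIV. chi (c * (F (y + d) - F y))))"
    unfolding sum_distrib_left
    by (subst sum.swap) (intro sum.cong refl, simp add: add[symmetric] algebra_simps)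
  also have "\<dots> = (\<Sum>c\<in>(UNIV :: 'a set). if c = 0 then of_nat CARD('a) else 0)"
    by (intro sum.cong refl) (auto simp: zero)
  also have "\<dots> = of_nat CARD('a)" by simp
  finally have "card ?S = 1" by simp
  then obtain x where "?S = {x}" by (rule card_1_singletonE)
  then have "F (y + d) - F y = b \<longleftrightarrow> y = x" for y by (auto dest: equalityD1)
  then show "\<exists>!x. F (x + d) - F x = b" by simp
qed

text \<open>Here \<open>r\<close> stands for the squared amplitude \<open>p ^ (n + s)\<close>, which
  is at least the field size.\<close>

lemma planar_if_plateaued_two_to_one:
  assumes F: "two_to_one p n F" "CARD('a) = p ^ n" "odd p"
    and plateau: "\<And>b. b \<noteq> 0 \<Longrightarrow> \<exists>r \<ge> real CARD('a). \<forall>a. (norm (W F b a))\<^sup>2 \<in> {0, r}"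
  shows "planar F"
proof (rule planar_if_flat)
  let ?q = "real CARD('a)"
  let ?N = "\<lambda>b a. (norm (W F b a))\<^sup>2"
  obtain y0 D where card_D: "2 * card D + 1 = CARD('a)"
    and "\<forall>f :: 'a \<Rightarrow> nat \<Rightarrow> complex.
      (\<Sum>y\<in>UNIV. of_nat (card (F -` {y})) * f y (card (F -` {y}))) = f y0 1 + 2 * (\<Sum>y\<in>D. f y 2)"
    using two_to_one_sum[OF F] by (elim exE conjE)
  then have split: "(\<Sum>y\<in>UNIV. of_nat (card (F -` {y})) * f y (card (F -` {y})))
      = f y0 1 + 2 * (\<Sum>y\<in>D. f y 2)"
    for f :: "'a \<Rightarrow> nat \<Rightarrow> complex" by simp
  have W0: "W F b 0 \<noteq> 0" for b
  proof -
    have "W F b 0 = chi (b * y0) + 2 * (\<Sum>y\<in>D. chi (b * y))"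
      using sum_card_vimage[of "\<lambda>y. chi (b * y)" F] split[of "\<lambda>y _. chi (b * y)"]
      by (simp add: W_def)
    also have "\<dots> \<noteq> 0"
      by (rule root_of_unity_plus_double_sum_nonzero[where p = "CHAR('a)"])
        (auto simp: power_CHAR)
    finally show ?thesis .
  qed
  have ge: "?q \<le> ?N b 0" if "b \<noteq> 0" for b
    using plateau[OF that] W0[of b] by auto
  \<comment> \<open>Taking the fibre size itself as \<open>f\<close>, the squared fibre sizes add up
    to \<open>1 + 4 * card D\<close>, that is \<open>2 * ?q - 1\<close>.\<close>
  have "complex_of_real (\<Sum>b\<in>UNIV. ?N b 0) = of_nat CARD('a) * (1 + 2 * (2 * of_nat (card D)))"
    unfolding of_real_sum sum_norm_sq_W_0 using split[of "\<lambda>_ k. of_nat k"] by simp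
  also have "\<dots> = of_real (?q * (1 + 2 * (?q - 1)))"
    unfolding card_D[symmetric] by simp
  finally have "(\<Sum>b\<in>UNIV. ?N b 0) = ?q * (1 + 2 * (?q - 1))"
    by (simp only: of_real_eq_iff)
  \<comment> \<open>Removing the term \<open>b = 0\<close> leaves \<open>?q * (?q - 1)\<close> for
    \<open>?q - 1\<close> terms that are each at least \<open>?q\<close>, so all of them equal
    \<open>?q\<close>.\<close>
  moreover have "?N 0 0 = ?q\<^sup>2" by (simp add: W_def norm_power)
  ultimately have "(\<Sum>b\<in>UNIV - {0}. ?N b 0) = ?q * (?q - 1)"
    by (simp add: sum_diff1 power2_eq_square algebra_simps)
  also have "\<dots> = (\<Sum>b\<in>UNIV - {0 :: 'a}. ?q)"
    by (simp add: card_Diff_singleton)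
  finally have "(\<Sum>b\<in>UNIV - {0}. ?N b 0 - ?q) = 0"
    by (simp add: sum_subtractf)
  then have eq: "?N b 0 = ?q" if "b \<noteq> 0" for b
    using sum_nonneg_0[of "UNIV - {0}" "\<lambda>b. ?N b 0 - ?q" b] that ge by simp
  fix a b :: 'a assume b: "b \<noteq> 0"
  have le: "?N b c \<le> ?q" for c
  proof -
    \<comment> \<open>The same \<open>r\<close> governs both arguments, and the nonzero value at
      \<open>0\<close> identifies it as \<open>?q\<close>.\<close>
    obtain r where r: "?N b c \<in> {0, r}" "?N b 0 \<in> {0, r}" using plateau[OF b] by blast
    then have "r = ?q" using eq[OF b] by auto
    then show ?thesis using r by auto
  qed
  \<comment> \<open>By Parseval the \<open>?q\<close> values sum to the square of \<open>?q\<close>;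
    none exceeds \<open>?q\<close>, so none can fall short.\<close>
  have "(\<Sum>c\<in>UNIV. ?q - ?N b c) = 0"
    unfolding sum_subtractf W_sum_norm_sq by (simp add: power2_eq_square)
  then show "?N b a = ?q"
    using sum_nonneg_0[of UNIV "\<lambda>c. ?q - ?N b c" a] le by simp
qed

end

section \<open>The trace character\<close>

lemma abs_trace_add:
  fixes x y :: "'a::finite_field"
  assumes "prime p" "CARD('a) = p ^ n"
  shows "abs_trace p n (x + y) = abs_trace p n x + abs_trace p n y"
proof -
  have "(x + y) ^ (p ^ i) = x ^ (p ^ i) + y ^ (p ^ i)" for i
    using CHAR_eq[OF assms] assms(1) by (intro freshmans_dream') auto
  then show ?thesis by (simp add: abs_trace_def sum.distrib)
qed

text \<open>The trace is a nonzero polynomial of degree at most \<open>p ^ (n - 1)\<close>, too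
  small to vanish at all \<open>p ^ n\<close> elements.\<close>

lemma abs_trace_nontrivial:
  assumes "prime p" "CARD('a::finite_field) = p ^ n"
  shows "\<exists>x :: 'a. abs_trace p n x \<noteq> 0"
proof (rule ccontr)
  assume "\<not> ?thesis"
  then have all: "abs_trace p n x = 0" for x :: 'a by blast
  have p: "p > 1" using assms(1) prime_gt_1_nat by blast
  \<comment> \<open>Two distinct elements exclude \<open>n = 0\<close>, so a top exponent
    \<open>p ^ m\<close> exists.\<close>
  have "card {0, 1 :: 'a} \<le> CARD('a)" by (intro card_mono) auto
  then obtain m where m: "n = Suc m" using assms(2) by (cases n) auto
  define P :: "'a poly" where "P = (\<Sum>i<n. monom 1 (p ^ i))"
  have "coeff P (p ^ m) = (\<Sum>i<n. if i = m then 1 else 0)"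
    unfolding P_def coeff_sum using p by (intro sum.cong refl) (auto simp:)
  then have "P \<noteq> 0" using m by auto
  moreover have "{x. poly P x = 0} = UNIV"
    using all by (simp add: P_def poly_sum poly_monom abs_trace_def)
  moreover have "degree P \<le> p ^ m"
    unfolding P_def
  proof (intro degree_sum_le)
    fix i assume "i \<in> {..<n}"
    then have "p ^ i \<le> p ^ m" using m p by (intro power_increasing) auto
    then show "degree (monom (1 :: 'a) (p ^ i)) \<le> p ^ m" by (simp add: degree_monom_eq)
  qed simp
  ultimately have "CARD('a) \<le> p ^ m"
    using card_poly_roots_bound[of P] by simp
  moreover have "p ^ m < p ^ n" using p m by simp
  ultimately show False using assms(2) by simp
qed

lemma of_int_trace_rep:
  fixes x :: "'a::finite_field"
  assumes "prime p" "CARD('a) = p ^ n"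
  shows "of_int (trace_rep p n x) = abs_trace p n x"
  using theI'[OF abs_trace_prime_field[OF assms, of x]]
  by (simp add: trace_rep_def prime_field_rep_def)

lemma zeta_powi_eq_1_iff:
  assumes "p > 0"
  shows "zeta p powi k = 1 \<longleftrightarrow> int p dvd k"
proof -
  have "zeta p powi k = exp (of_int k * (2 * of_real pi * \<i> / of_nat p))"
    by (simp add: zeta_def exp_power_int)
  also have "\<dots> = 1 \<longleftrightarrow> (\<exists>m::int. 2 * pi * of_int k / real p = of_int (2 * m) * pi)"
    by (simp add: exp_eq_1 algebra_simps)
  also have "\<dots> \<longleftrightarrow> (\<exists>m::int. k = int p * m)"
  proof (intro ex_cong1)
    fix m :: int
    have "2 * pi * of_int k / real p = of_int (2 * m) * pi \<longleftrightarrow> real_of_int k = of_int (int p * m)"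
      using assms by (simp add: field_simps)
    then show "2 * pi * of_int k / real p = of_int (2 * m) * pi \<longleftrightarrow> k = int p * m"
      by (simp only: of_int_eq_iff)
  qed
  finally show ?thesis by (simp add: dvd_def)
qed

lemma zeta_powi_cong:
  assumes "p > 0" "int p dvd k - l"
  shows "zeta p powi k = zeta p powi l"
proof -
  have nz: "zeta p \<noteq> 0" by (simp add: zeta_def)
  then have "zeta p powi k = zeta p powi l * zeta p powi (k - l)"
    by (simp add: power_int_add[symmetric])
  then show ?thesis using zeta_powi_eq_1_iff[OF assms(1)] assms(2) by simp
qed

text \<open>Least residues make \<open>trace_rep\<close> additive only modulo \<open>p\<close>. That
  suffices, since powers of \<open>zeta p\<close> depend only on the exponent modulo
  \<open>p\<close>, and divisibility by \<open>p\<close> can be tested in the field, whose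
  characteristic is \<open>p\<close>.\<close>

lemma
  assumes p: "prime p" "CARD('a::finite_field) = p ^ n"
  shows additive_character_trace: "additive_character (\<lambda>x :: 'a. zeta p powi trace_rep p n x)"
    and zeta_powi_trace_diff:
      "zeta p powi (trace_rep p n x - trace_rep p n y) = zeta p powi trace_rep p n (x - y :: 'a)"
proof -
  have p0: "p > 0" using p(1) prime_gt_0_nat by blast
  have ch: "CHAR('a) = p" by (rule CHAR_eq[OF p])
  have dvd_iff: "int p dvd k \<longleftrightarrow> (of_int k :: 'a) = 0" for k
    by (simp add: of_int_eq_0_iff_char_dvd ch)
  note [simp] = of_int_trace_rep[OF p]
  have tr_add: "abs_trace p n (u + v) = abs_trace p n u + abs_trace p n v" for u v :: 'a
    by (rule abs_trace_add[OF p])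
  have nz: "zeta p \<noteq> 0" by (simp add: zeta_def)
  show "additive_character (\<lambda>x :: 'a. zeta p powi trace_rep p n x)"
  proof
    have "abs_trace p n (0 :: 'a) = 0" using p0 by (simp add: abs_trace_def power_0_left)
    then show "zeta p powi trace_rep p n (0 :: 'a) = 1"
      by (simp add: zeta_powi_eq_1_iff p0 dvd_iff)
    fix u v :: 'a
    have "zeta p powi trace_rep p n (u + v) = zeta p powi (trace_rep p n u + trace_rep p n v)"
      by (rule zeta_powi_cong[OF p0]) (simp add: dvd_iff tr_add)
    then show "zeta p powi trace_rep p n (u + v) = zeta p powi trace_rep p n u * zeta p powi trace_rep p n v"
      using nz by (simp add: power_int_add)
  next
    show "\<exists>x :: 'a. zeta p powi trace_rep p n x \<noteq> 1"
      using abs_trace_nontrivial[OF p] by (simp add: zeta_powi_eq_1_iff p0 dvd_iff)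
  qed
  show "zeta p powi (trace_rep p n x - trace_rep p n y) = zeta p powi trace_rep p n (x - y)"
    using tr_add[of "x - y" y] by (intro zeta_powi_cong[OF p0]) (simp add: dvd_iff)
qed

theorem theorem6p4:
  fixes p n :: nat and F :: "'a::finite_field \<Rightarrow> 'a"
  assumes "prime p" and "odd p"
    and "CARD('a) = p ^ n"
    and "plateaued p n F"
    and "two_to_one p n F"
  shows "planar F"
proof -
  interpret additive_character "\<lambda>x :: 'a. zeta p powi trace_rep p n x"
    by (rule additive_character_trace[OF assms(1,3)])
  have walsh: "walsh p n F b a = W F b a" for a b
    by (simp add: walsh_def W_def zeta_powi_trace_diff[OF assms(1,3)])
  have p: "real p \<ge> 1"
    using prime_gt_0_nat[OF assms(1)] by simp
  show ?thesis
  proof (rule planar_if_plateaued_two_to_one[OF assms(5,3,2)])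
    fix b :: 'a assume "b \<noteq> 0"
    then obtain s where s: "\<And>a. norm (W F b a) \<in> {0, real p powr ((real n + real s) / 2)}"
      using assms(4) unfolding plateaued_def walsh by blast
    \<comment> \<open>Squaring removes the half-integral exponent and provides the witness for
      \<open>r\<close>.\<close>
    have "(real p powr ((real n + real s) / 2))\<^sup>2 = real p ^ (n + s)"
      using p powr_realpow[of "real p" "n + s"] by (simp add: powr_power add_divide_distrib)
    then have "\<forall>a. (norm (W F b a))\<^sup>2 \<in> {0, real p ^ (n + s)}"
      using s by fastforce
    moreover have "real CARD('a) \<le> real p ^ (n + s)"
      using p by (simp add: assms(3) power_increasing)
    ultimately show "\<exists>r \<ge> real CARD('a). \<forall>a. (norm (W F b a))\<^sup>2 \<in> {0, r}" by blast
  qed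
qed

end
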